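(* Let $\Gamma$ be a weakly connected $PT$-graph with exactly two red arcs $(u_1,v_1)$ and $(u_2,v_2)$, and with no multiple blue arcs. Let $\Gamma_T$ be the subgraph of $\Gamma$ with vertex set $\{u_1,v_1,u_2,v_2\}$ whose arc set consists of the two red arcs and the blue arcs $(u_1,v_2)$ and $(u_2,v_1)$. Let $\Gamma_P$ be the subgraph of $\Gamma$ on the full vertex set whose arcs are exactly those arcs of $\Gamma$ not belonging to $\Gamma_T$. Then $\Gamma_P$ is composed of disjoint directed cycles. Moreover, if the $(0,1,-1)$-matrices corresponding to $\Gamma$ have finite multiplicative order, then either $\Gamma$ or its reverse is of one of the following four types. (Type 1) $\Gamma_P$ is a single directed cycle. (Type 2(c)) $\Gamma_P$ consists of two disjoint directed cycles, with $u_1$ and $u_2$ belonging to one of these cycles and $v_1$ and $v_2$ to the other; the vertices $u_1,u_2,v_1,v_2$ are distinct. (Type 2(d)) $\Gamma_P$ consists of two disjoint directed cycles, with $u_1$ belonging to one of these cycles and $u_2,v_1,v_2$ to the other; the vertices $v_1$ and $u_2$ are distinct, but $v_2$ may coincide with one of these. (Type 3(c)) $\Gamma_P$ consists of three disjoint directed cycles; $u_1$ and $u_2$ belong to the same cycle of $\Gamma_P$, and each of the other two cycles contains exactly one of $v_1$, $v_2$; the vertices $u_1,u_2,v_1,v_2$ are distinct.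
   Context: A $T$-block is an $n\times n$ matrix $T(i_1,j_1,i_2,j_2)$ (with $i_1\neq i_2$, $j_1\neq j_2$) having $1$ in positions $(i_1,j_1)$ and $(i_2,j_2)$, $-1$ in positions $(i_1,j_2)$ and $(i_2,j_1)$, and $0$ elsewhere. A $PT$-matrix is a matrix $P+T$ with $P$ an $n\times n$ permutation matrix and $T$ an $n\times n$ $T$-block. To an $n\times n$ $(0,1,-1)$-matrix $A$ one associates a 2-arc-coloured digraph with vertices $v_1,\dots,v_n$: $(v_i,v_j)$ is a blue arc if $A_{ij}=1$, a red arc if $A_{ij}=-1$, and not an arc if $A_{ij}=0$; conversely a 2-arc-coloured digraph together with an ordering of its vertices determines a $(0,1,-1)$-matrix in this way (a "matrix corresponding to" the graph). A $PT$-graph is a graph associated to a $PT$-matrix. A digraph is weakly connected if its underlying undirected graph is connected. The reverse of a digraph is obtained by reversing the direction of every arc, keeping colours. A "multiple blue arc" would correspond to an entry equal to $2$.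
   Formalization: In type 2(d) the heads v1, v2 may be numbered independently of the tails u1, u2, so either head may coincide with u2; with heads paired to tails by the red arcs the claim fails for the matrix with rows (1,-1,1,0),(1,0,0,0),(0,1,0,0),(-1,1,0,1), of order 4. *)

theory Defs
  imports
    "Jordan_Normal_Form.Matrix"
    "HOL-Combinatorics.Permutations"
    "Graph_Theory.Graph_Theory"
begin

section \<open>PT-matrices\<close>

definition T_block :: "nat \<Rightarrow> nat \<Rightarrow> nat \<Rightarrow> nat \<Rightarrow> nat \<Rightarrow> int mat" where
  "T_block n i\<^sub>1 j\<^sub>1 i\<^sub>2 j\<^sub>2 = mat n n (\<lambda>p.
     if p \<in> {(i\<^sub>1, j\<^sub>1), (i\<^sub>2, j\<^sub>2)} then 1
     else if p \<in> {(i\<^sub>1, j\<^sub>2), (i\<^sub>2, j\<^sub>1)} then - 1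
     else 0)"

definition is_T_block :: "nat \<Rightarrow> int mat \<Rightarrow> bool" where
  "is_T_block n T \<longleftrightarrow> (\<exists>i\<^sub>1<n. \<exists>j\<^sub>1<n. \<exists>i\<^sub>2<n. \<exists>j\<^sub>2<n.
     i\<^sub>1 \<noteq> i\<^sub>2 \<and> j\<^sub>1 \<noteq> j\<^sub>2 \<and> T = T_block n i\<^sub>1 j\<^sub>1 i\<^sub>2 j\<^sub>2)"

definition is_permutation_mat :: "nat \<Rightarrow> int mat \<Rightarrow> bool" where
  "is_permutation_mat n P \<longleftrightarrow>
     (\<exists>\<pi>. \<pi> permutes {..<n} \<and> P = mat n n (\<lambda>(i, j). if j = \<pi> i then 1 else 0))"

definition is_PT_mat :: "nat \<Rightarrow> int mat \<Rightarrow> bool" where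
  "is_PT_mat n A \<longleftrightarrow> (\<exists>P T. is_permutation_mat n P \<and> is_T_block n T \<and> A = P + T)"

definition finite_mult_order :: "int mat \<Rightarrow> bool" where
  "finite_mult_order A \<longleftrightarrow> (\<exists>k>0. A ^\<^sub>m k = 1\<^sub>m (dim_row A))"


section \<open>2-arc-coloured digraphs\<close>

text \<open>A 2-arc-coloured digraph is a digraph \<open>G\<close> (loops and, a priori, parallel arcs are
  allowed) together with a colouring \<open>c\<close> of its arcs.\<close>

datatype colour = Blue | Red

definition arcs_between ::
  "('v, 'a) pre_digraph \<Rightarrow> ('a \<Rightarrow> colour) \<Rightarrow> colour \<Rightarrow> 'v \<Rightarrow> 'v \<Rightarrow> 'a set" where
  "arcs_between G c k x y = {e \<in> arcs G. c e = k \<and> arc_to_ends G e = (x, y)}"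

text \<open>\<open>A\<close> is the matrix corresponding to the coloured digraph for the ordering \<open>vs\<close> of its
  vertices. An entry \<open>1\<close> is a blue arc, \<open>- 1\<close> a red arc, \<open>0\<close> no arc. The entries of a
  PT-matrix lie in \<open>{- 1, 0, 1, 2}\<close>; an entry \<open>2\<close> is a double blue arc, which is why
  multiplicities are counted here.\<close>

definition corresponding_mat ::
  "('v, 'a) pre_digraph \<Rightarrow> ('a \<Rightarrow> colour) \<Rightarrow> 'v list \<Rightarrow> int mat \<Rightarrow> bool" where
  "corresponding_mat G c vs A \<longleftrightarrow>
     distinct vs \<and> set vs = verts G \<and> A \<in> carrier_mat (length vs) (length vs) \<and>
     (\<forall>i<length vs. \<forall>j<length vs.
        card (arcs_between G c Blue (vs ! i) (vs ! j)) = nat (A $$ (i, j)) \<and>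
        card (arcs_between G c Red (vs ! i) (vs ! j)) = nat (- A $$ (i, j)))"

definition PT_graph :: "('v, 'a) pre_digraph \<Rightarrow> ('a \<Rightarrow> colour) \<Rightarrow> bool" where
  "PT_graph G c \<longleftrightarrow>
     fin_digraph G \<and> (\<exists>vs A. is_PT_mat (length vs) A \<and> corresponding_mat G c vs A)"

definition no_multiple_blue_arcs :: "('v, 'a) pre_digraph \<Rightarrow> ('a \<Rightarrow> colour) \<Rightarrow> bool" where
  "no_multiple_blue_arcs G c \<longleftrightarrow>
     (\<forall>e\<in>arcs G. \<forall>f\<in>arcs G. c e = Blue \<and> c f = Blue \<and> arc_to_ends G e = arc_to_ends G f
        \<longrightarrow> e = f)"

definition exactly_two_red_arcs ::
  "('v, 'a) pre_digraph \<Rightarrow> ('a \<Rightarrow> colour) \<Rightarrow> 'v \<Rightarrow> 'v \<Rightarrow> 'v \<Rightarrow> 'v \<Rightarrow> bool" where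
  "exactly_two_red_arcs G c u\<^sub>1 v\<^sub>1 u\<^sub>2 v\<^sub>2 \<longleftrightarrow>
     (\<exists>r\<^sub>1 r\<^sub>2. r\<^sub>1 \<noteq> r\<^sub>2 \<and> {e \<in> arcs G. c e = Red} = {r\<^sub>1, r\<^sub>2} \<and>
        arc_to_ends G r\<^sub>1 = (u\<^sub>1, v\<^sub>1) \<and> arc_to_ends G r\<^sub>2 = (u\<^sub>2, v\<^sub>2))"

text \<open>The colouring of the reverse is unchanged, since the arcs themselves are.\<close>

definition reverse_digraph :: "('v, 'a) pre_digraph \<Rightarrow> ('v, 'a) pre_digraph" where
  "reverse_digraph G = \<lparr>verts = verts G, arcs = arcs G, tail = head G, head = tail G\<rparr>"

definition T_subgraph ::
  "('v, 'a) pre_digraph \<Rightarrow> ('a \<Rightarrow> colour) \<Rightarrow> 'v \<Rightarrow> 'v \<Rightarrow> 'v \<Rightarrow> 'v \<Rightarrow> ('v, 'a) pre_digraph" where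
  "T_subgraph G c u\<^sub>1 v\<^sub>1 u\<^sub>2 v\<^sub>2 =
     \<lparr>verts = {u\<^sub>1, v\<^sub>1, u\<^sub>2, v\<^sub>2},
      arcs = arcs_between G c Red u\<^sub>1 v\<^sub>1 \<union> arcs_between G c Red u\<^sub>2 v\<^sub>2 \<union>
             arcs_between G c Blue u\<^sub>1 v\<^sub>2 \<union> arcs_between G c Blue u\<^sub>2 v\<^sub>1,
      tail = tail G, head = head G\<rparr>"

definition P_subgraph ::
  "('v, 'a) pre_digraph \<Rightarrow> ('a \<Rightarrow> colour) \<Rightarrow> 'v \<Rightarrow> 'v \<Rightarrow> 'v \<Rightarrow> 'v \<Rightarrow> ('v, 'a) pre_digraph" where
  "P_subgraph G c u\<^sub>1 v\<^sub>1 u\<^sub>2 v\<^sub>2 =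
     \<lparr>verts = verts G, arcs = arcs G - arcs (T_subgraph G c u\<^sub>1 v\<^sub>1 u\<^sub>2 v\<^sub>2),
      tail = tail G, head = head G\<rparr>"


section \<open>Directed cycles\<close>

text \<open>A single loop is a directed cycle of length 1, and two opposite arcs form a directed
  cycle of length 2.\<close>

definition directed_cycle :: "('v, 'a) pre_digraph \<Rightarrow> bool" where
  "directed_cycle C \<longleftrightarrow>
     (\<exists>p. pre_digraph.cycle C p \<and> arcs C = set p \<and> verts C = tail C ` set p)"

definition consists_of_disjoint_cycles ::
  "('v, 'a) pre_digraph \<Rightarrow> ('v, 'a) pre_digraph set \<Rightarrow> bool" where
  "consists_of_disjoint_cycles H \<C> \<longleftrightarrow>
     (\<forall>C\<in>\<C>. subgraph C H \<and> directed_cycle C) \<and>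
     pairwise (\<lambda>C D. verts C \<inter> verts D = {}) \<C> \<and>
     verts H = (\<Union>C\<in>\<C>. verts C) \<and> arcs H = (\<Union>C\<in>\<C>. arcs C)"


section \<open>The four types\<close>

text \<open>In the following, \<open>H\<close> is the subgraph \<open>P_subgraph\<close> of a PT-graph, \<open>u\<^sub>1\<close> and \<open>u\<^sub>2\<close> are the
  tails and \<open>v\<^sub>1\<close> and \<open>v\<^sub>2\<close> the heads of its two red arcs.\<close>

definition type_1 :: "('v, 'a) pre_digraph \<Rightarrow> bool" where
  "type_1 H \<longleftrightarrow> directed_cycle H"

definition type_2c :: "('v, 'a) pre_digraph \<Rightarrow> 'v \<Rightarrow> 'v \<Rightarrow> 'v \<Rightarrow> 'v \<Rightarrow> bool" where
  "type_2c H u\<^sub>1 u\<^sub>2 v\<^sub>1 v\<^sub>2 \<longleftrightarrow>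
     (\<exists>C D. C \<noteq> D \<and> consists_of_disjoint_cycles H {C, D} \<and>
        u\<^sub>1 \<in> verts C \<and> u\<^sub>2 \<in> verts C \<and> v\<^sub>1 \<in> verts D \<and> v\<^sub>2 \<in> verts D) \<and>
     distinct [u\<^sub>1, u\<^sub>2, v\<^sub>1, v\<^sub>2]"

text \<open>Coincidence of \<open>v\<^sub>2\<close> with \<open>u\<^sub>2\<close> is allowed.\<close>

definition type_2d :: "('v, 'a) pre_digraph \<Rightarrow> 'v \<Rightarrow> 'v \<Rightarrow> 'v \<Rightarrow> 'v \<Rightarrow> bool" where
  "type_2d H u\<^sub>1 u\<^sub>2 v\<^sub>1 v\<^sub>2 \<longleftrightarrow>
     (\<exists>C D. C \<noteq> D \<and> consists_of_disjoint_cycles H {C, D} \<and>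
        u\<^sub>1 \<in> verts C \<and> u\<^sub>2 \<in> verts D \<and> v\<^sub>1 \<in> verts D \<and> v\<^sub>2 \<in> verts D) \<and>
     v\<^sub>1 \<noteq> u\<^sub>2"

definition type_3c :: "('v, 'a) pre_digraph \<Rightarrow> 'v \<Rightarrow> 'v \<Rightarrow> 'v \<Rightarrow> 'v \<Rightarrow> bool" where
  "type_3c H u\<^sub>1 u\<^sub>2 v\<^sub>1 v\<^sub>2 \<longleftrightarrow>
     (\<exists>C D E. distinct [C, D, E] \<and> consists_of_disjoint_cycles H {C, D, E} \<and>
        u\<^sub>1 \<in> verts C \<and> u\<^sub>2 \<in> verts C \<and> v\<^sub>1 \<in> verts D \<and> v\<^sub>2 \<in> verts E) \<and>
     distinct [u\<^sub>1, u\<^sub>2, v\<^sub>1, v\<^sub>2]"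

text \<open>The types are understood up to the numbering of the two tails and of the two heads of the
  red arcs, which matters for type 2(d) only. There the numbering of the tails selects the one
  that lies on a cycle of its own. The numbering of the heads selects one that differs from
  \<open>u\<^sub>2\<close>; it is not tied to the numbering of the tails by the red arcs, because a head that
  coincides with \<open>u\<^sub>2\<close> can belong to either red arc. It belongs to the red arc at \<open>u\<^sub>2\<close> if that
  arc is a loop. It belongs to the red arc at \<open>u\<^sub>1\<close> in the graph of the PT-matrix with rows
  \<open>(1, -1, 1, 0)\<close>, \<open>(1, 0, 0, 0)\<close>, \<open>(0, 1, 0, 0)\<close>, \<open>(-1, 1, 0, 1)\<close>, which has
  multiplicative order 4 and red arcs \<open>(4, 1)\<close> and \<open>(1, 2)\<close>.\<close>

definition of_listed_type ::
  "('v, 'a) pre_digraph \<Rightarrow> ('a \<Rightarrow> colour) \<Rightarrow> 'v \<Rightarrow> 'v \<Rightarrow> 'v \<Rightarrow> 'v \<Rightarrow> bool" where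
  "of_listed_type G c u\<^sub>1 v\<^sub>1 u\<^sub>2 v\<^sub>2 \<longleftrightarrow>
     (\<exists>x\<^sub>1 x\<^sub>2 y\<^sub>1 y\<^sub>2. {x\<^sub>1, x\<^sub>2} = {u\<^sub>1, u\<^sub>2} \<and> {y\<^sub>1, y\<^sub>2} = {v\<^sub>1, v\<^sub>2} \<and>
        (let H = P_subgraph G c u\<^sub>1 v\<^sub>1 u\<^sub>2 v\<^sub>2 in
           type_1 H \<or> type_2c H x\<^sub>1 x\<^sub>2 y\<^sub>1 y\<^sub>2 \<or> type_2d H x\<^sub>1 x\<^sub>2 y\<^sub>1 y\<^sub>2 \<or> type_3c H x\<^sub>1 x\<^sub>2 y\<^sub>1 y\<^sub>2))"

end

theory Submission
  imports Defs Complex_Main "HOL-Combinatorics.Cycles"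
begin

text \<open>A \<open>PT\<close>-matrix is a rank-one perturbation \<open>P + a b\<^sup>T\<close> of a permutation matrix, with
  \<open>a = e\<^bsub>u\<^sub>1\<^esub> - e\<^bsub>u\<^sub>2\<^esub>\<close> and \<open>b = e\<^bsub>v\<^sub>2\<^esub> - e\<^bsub>v\<^sub>1\<^esub>\<close>. A number \<open>t\<close> with \<open>t ^ N \<noteq> 1\<close>, where \<open>P ^ N = 1\<close>, is
  an eigenvalue iff \<open>b\<^sup>T (t - P)\<^sup>-\<^sup>1 a = 1\<close>, and only the pairs \<open>(v\<^sub>i, u\<^sub>j)\<close> on a common cycle of \<open>P\<close>
  contribute to the left-hand side. If all these pairs contribute with the same sign, then the
  intermediate value theorem gives an eigenvalue greater than 1 or one in \<open>(0, 1)\<close>. If there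
  are no such pairs and the four vertices lie on four cycles, then there is a nontrivial Jordan
  block for the eigenvalue 1. All these cases are excluded by a finite order. By weak
  connectedness, every cycle of \<open>P\<close> contains one of the four vertices, and the distributions of
  the vertices over the cycles that remain are the listed ones, up to reversal.\<close>

section \<open>Orbits and the resolvent of a permutation matrix\<close>

lemma permutation_in_orbit_iff:
  "permutation \<sigma> \<Longrightarrow> x \<in> orbit \<sigma> y \<longleftrightarrow> orbit \<sigma> x = orbit \<sigma> y"
  by (metis cyclic_on_orbit' orbit_cyclic_eq3 permutation_self_in_orbit)

text \<open>This is the action on functions on the vertices of \<open>P + T\<close>, where \<open>P\<close> is the matrix of \<open>\<sigma>\<close> and
  the entries \<open>- 1\<close> of \<open>T\<close> are at \<open>(u\<^sub>1, v\<^sub>1)\<close> and \<open>(u\<^sub>2, v\<^sub>2)\<close>.\<close>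

definition pt_op :: "('v \<Rightarrow> 'v) \<Rightarrow> 'v \<Rightarrow> 'v \<Rightarrow> 'v \<Rightarrow> 'v \<Rightarrow> ('v \<Rightarrow> real) \<Rightarrow> 'v \<Rightarrow> real" where
  "pt_op \<sigma> u\<^sub>1 v\<^sub>1 u\<^sub>2 v\<^sub>2 z x =
     z (\<sigma> x) + (of_bool (x = u\<^sub>1) - of_bool (x = u\<^sub>2)) * (z v\<^sub>2 - z v\<^sub>1)"

text \<open>If \<open>\<sigma> ^^ N = id\<close>, then \<open>t ^ N - 1\<close> times the inverse of
  \<open>t - P\<close> is the sum of the \<open>t ^ (N - 1 - k) P ^ k\<close> for
  \<open>k < N\<close>; this is its entry at \<open>(v, u)\<close>. Without the denominator it also
  makes sense at \<open>t = 1\<close>.\<close>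

definition visits :: "('v \<Rightarrow> 'v) \<Rightarrow> nat \<Rightarrow> 'v \<Rightarrow> 'v \<Rightarrow> real \<Rightarrow> real" where
  "visits \<sigma> N v u t = (\<Sum>k<N. of_bool ((\<sigma> ^^ k) v = u) * t ^ (N - Suc k))"

text \<open>Entrywise form of a telescoping identity: \<open>t - P\<close> times the sum of the
  \<open>t ^ (N - 1 - k) P ^ k\<close> is \<open>t ^ N - P ^ N\<close>.\<close>

lemma visits_step:
  assumes "\<sigma> ^^ N = id"
  shows "t * visits \<sigma> N v u t - visits \<sigma> N (\<sigma> v) u t = of_bool (v = u) * (t ^ N - 1)"
proof -
  define f where "f k = of_bool ((\<sigma> ^^ k) v = u) * t ^ (N - k)" for k
  have "t * visits \<sigma> N v u t = (\<Sum>k<N. f k)"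
    unfolding visits_def f_def sum_distrib_left
    by (intro sum.cong refl) (simp add: Suc_diff_Suc flip: power_Suc)
  moreover have "visits \<sigma> N (\<sigma> v) u t = (\<Sum>k<N. f (Suc k))"
    unfolding visits_def f_def by (simp add: funpow_swap1)
  ultimately have "t * visits \<sigma> N v u t - visits \<sigma> N (\<sigma> v) u t = f 0 - f N"
    using sum_lessThan_telescope'[of f N] by (simp add: sum_subtractf)
  then show ?thesis
    using assms by (simp add: f_def algebra_simps)
qed

lemma visits_nonneg: "0 \<le> t \<Longrightarrow> 0 \<le> visits \<sigma> N v u t"
  unfolding visits_def by (intro sum_nonneg) simp

lemma visits_eq_0: "u \<notin> orbit \<sigma> v \<Longrightarrow> permutation \<sigma> \<Longrightarrow> visits \<sigma> N v u t = 0"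
  unfolding visits_def by (intro sum.neutral) (auto simp: orbit_altdef_permutation)

text \<open>Only \<open>k = N - 1\<close> contributes to the constant term, and
  \<open>\<sigma> ^^ (N - 1)\<close> is the inverse of \<open>\<sigma>\<close>.\<close>

lemma visits_at_0:
  assumes "\<sigma> ^^ N = id" and "0 < N" and "\<sigma> u \<noteq> v"
  shows "visits \<sigma> N v u 0 = 0"
proof -
  have "(\<sigma> ^^ (N - 1)) v \<noteq> u"
  proof
    assume "(\<sigma> ^^ (N - 1)) v = u"
    then have "(\<sigma> ^^ Suc (N - 1)) v = \<sigma> u"
      by simp
    then show False
      using assms by simp
  qed
  then have "of_bool ((\<sigma> ^^ k) v = u) * (0 :: real) ^ (N - Suc k) = 0" if "k < N" for k
    using that by (cases "k = N - 1") auto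
  then show ?thesis
    unfolding visits_def by (intro sum.neutral) auto
qed

text \<open>At 1 the sum counts visits to \<open>u\<close> in \<open>N\<close> steps, and since
  \<open>N\<close> is a period of \<open>v\<close> these steps run through the whole orbit.\<close>

lemma visits_at_1_pos:
  assumes "\<sigma> ^^ N = id" and "0 < N" and "u \<in> orbit \<sigma> v"
  shows "0 < visits \<sigma> N v u 1"
proof -
  have "(\<sigma> ^^ N) v = v"
    using assms(1) by simp
  then obtain m where m: "m < N" "(\<sigma> ^^ m) v = u"
    using assms(2,3) by (auto simp: orbit_altdef_bounded[OF _ assms(2)])
  then have "(1 :: real) \<le> (\<Sum>k<N. of_bool ((\<sigma> ^^ k) v = u))"
    using member_le_sum[of m "{..<N}" "\<lambda>k. of_bool ((\<sigma> ^^ k) v = u) :: real"] by simp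
  then show ?thesis
    by (simp add: visits_def)
qed

text \<open>The degree is below \<open>N\<close>, so \<open>t ^ N\<close> dominates in the secular
  equation for large \<open>t\<close>.\<close>

lemma visits_le:
  assumes "1 \<le> t" and "0 < N"
  shows "visits \<sigma> N v u t \<le> N * t ^ (N - 1)"
proof -
  have "of_bool ((\<sigma> ^^ k) v = u) * t ^ (N - Suc k) \<le> t ^ (N - 1)" for k
    using assms by (auto intro: power_increasing)
  then have "visits \<sigma> N v u t \<le> (\<Sum>k<N. t ^ (N - 1))"
    unfolding visits_def by (intro sum_mono)
  then show ?thesis
    by simp
qed

lemma continuous_on_visits [continuous_intros]: "continuous_on S (visits \<sigma> N v u)"
  unfolding visits_def by (intro continuous_intros)

section \<open>Spectral obstructions to finite order\<close>

locale pt_finite_order =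
  fixes \<sigma> :: "'v \<Rightarrow> 'v" and u\<^sub>1 v\<^sub>1 u\<^sub>2 v\<^sub>2 :: 'v and K :: nat
  assumes perm: "permutation \<sigma>"
    and K: "0 < K" "\<And>z. (pt_op \<sigma> u\<^sub>1 v\<^sub>1 u\<^sub>2 v\<^sub>2 ^^ K) z = z"
    and not_arcs: "\<sigma> u\<^sub>1 \<noteq> v\<^sub>1" "\<sigma> u\<^sub>2 \<noteq> v\<^sub>2"
begin

abbreviation "L \<equiv> pt_op \<sigma> u\<^sub>1 v\<^sub>1 u\<^sub>2 v\<^sub>2"
abbreviation "Q \<equiv> orbit \<sigma>"

lemmas in_orbit_iff = permutation_in_orbit_iff[OF perm]

text \<open>For \<open>\<sigma> ^^ N = id\<close>, the vector \<open>x \<mapsto> visits x u / (t ^ N - 1)\<close> is column \<open>u\<close> of the resolvent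
  \<open>(t - P)\<^sup>-\<^sup>1\<close>, so the hypothesis says that \<open>t\<close> is a root of the secular equation of the
  rank-one perturbation \<open>P + T\<close> of \<open>P\<close>.\<close>

lemma eigenvalue_eq_1:
  assumes N: "\<sigma> ^^ N = id" "0 < N" and t: "0 < t"
    and root: "visits \<sigma> N v\<^sub>2 u\<^sub>1 t - visits \<sigma> N v\<^sub>2 u\<^sub>2 t - visits \<sigma> N v\<^sub>1 u\<^sub>1 t + visits \<sigma> N v\<^sub>1 u\<^sub>2 t
      = t ^ N - 1"
  shows "t = 1"
proof (rule ccontr)
  assume "t \<noteq> 1"
  then have D: "t ^ N - 1 \<noteq> 0"
    using power_eq_imp_eq_base[of t N 1] N t by auto
  \<comment> \<open>The resolvent applied to the difference of the indicators of
    \<open>u\<^sub>1\<close> and \<open>u\<^sub>2\<close>, which spans the range of the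
    perturbation.\<close>
  define z where "z x = (visits \<sigma> N x u\<^sub>1 t - visits \<sigma> N x u\<^sub>2 t) / (t ^ N - 1)" for x
  have "visits \<sigma> N (\<sigma> x) u t = t * visits \<sigma> N x u t - of_bool (x = u) * (t ^ N - 1)" for x u
    using visits_step[OF N(1), of t x u] by simp
  then have \<sigma>: "z (\<sigma> x) = t * z x - (of_bool (x = u\<^sub>1) - of_bool (x = u\<^sub>2))" for x
    unfolding z_def using D by (simp add: field_simps)
  \<comment> \<open>This is \<open>root\<close> divided by \<open>t ^ N - 1\<close>. It makes the
    perturbation cancel the defect between \<open>z (\<sigma> x)\<close> and \<open>t * z x\<close>,
    and it shows that the eigenvector \<open>z\<close> is not zero.\<close>
  have 1: "z v\<^sub>2 - z v\<^sub>1 = 1"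
  proof -
    have "z v\<^sub>2 - z v\<^sub>1 = (visits \<sigma> N v\<^sub>2 u\<^sub>1 t - visits \<sigma> N v\<^sub>2 u\<^sub>2 t - visits \<sigma> N v\<^sub>1 u\<^sub>1 t
        + visits \<sigma> N v\<^sub>1 u\<^sub>2 t) / (t ^ N - 1)"
      unfolding z_def diff_divide_distrib[symmetric] by (simp add: algebra_simps)
    then show ?thesis
      using root D by simp
  qed
  have L: "L (\<lambda>x. s * z x) = (\<lambda>x. s * t * z x)" for s
  proof
    fix x
    have "L (\<lambda>x. s * z x) x = s * z (\<sigma> x) + (of_bool (x = u\<^sub>1) - of_bool (x = u\<^sub>2)) * s * (z v\<^sub>2 - z v\<^sub>1)"
      by (simp add: pt_op_def algebra_simps)
    then show "L (\<lambda>x. s * z x) x = s * t * z x"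
      unfolding 1 \<sigma> by (simp add: algebra_simps)
  qed
  have "(L ^^ k) z = (\<lambda>x. t ^ k * z x)" for k
    by (induction k) (simp_all add: L power_Suc2 del: power_Suc)
  then have *: "z x = t ^ K * z x" for x
    using K(2)[of z] by metis
  have "t ^ K * (z v\<^sub>2 - z v\<^sub>1) = z v\<^sub>2 - z v\<^sub>1"
    by (simp only: right_diff_distrib *[symmetric])
  then have "t ^ K = 1"
    by (simp add: 1)
  then show False
    using power_eq_imp_eq_base[of t K 1] K(1) t \<open>t \<noteq> 1\<close> by auto
qed

text \<open>If the conclusion fails, only two pairs remain in the secular equation, both with sign
  plus. Their sum is positive at 1, where \<open>t ^ N - 1\<close> vanishes, and is overtaken by it
  for large \<open>t\<close>, so there is a root beyond 1.\<close>

lemma no_eigenvalue_greater_1: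
  assumes "Q u\<^sub>1 = Q v\<^sub>2 \<or> Q u\<^sub>2 = Q v\<^sub>1"
  shows "Q u\<^sub>1 = Q v\<^sub>1 \<or> Q u\<^sub>2 = Q v\<^sub>2"
proof (rule ccontr)
  assume neg: "\<not> ?thesis"
  obtain N where N: "\<sigma> ^^ N = id" "0 < N"
    using perm by (rule permutation_is_nilpotent)
  define F where "F t = visits \<sigma> N v\<^sub>2 u\<^sub>1 t + visits \<sigma> N v\<^sub>1 u\<^sub>2 t - (t ^ N - 1)" for t
  have root: "t = 1" if "0 < t" "F t = 0" for t
    using that neg eigenvalue_eq_1[OF N \<open>0 < t\<close>]
    by (simp add: F_def visits_eq_0 perm in_orbit_iff)
  have "0 < visits \<sigma> N v\<^sub>2 u\<^sub>1 1 + visits \<sigma> N v\<^sub>1 u\<^sub>2 1"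
    using assms visits_at_1_pos[OF N] visits_nonneg[of 1 \<sigma> N]
    by (metis add_nonneg_pos add_pos_nonneg in_orbit_iff zero_le_one)
  then have F1: "0 < F 1"
    by (simp add: F_def)
  \<comment> \<open>Each of the two visit terms is at most \<open>N * T ^ (N - 1)\<close>, so a
    factor \<open>T\<close> above \<open>2 * N\<close> suffices.\<close>
  define T where "T = real (2 * N + 1)"
  have T: "1 \<le> T"
    by (simp add: T_def)
  have "F T \<le> real N * T ^ (N - 1) + real N * T ^ (N - 1) - (T ^ N - 1)"
    unfolding F_def using visits_le[OF T N(2)] by (intro diff_mono add_mono) auto
  also have "T ^ N = T * T ^ (N - 1)"
    using N(2) by (simp add: power_eq_if)
  also have "real N * T ^ (N - 1) + real N * T ^ (N - 1) - (T * T ^ (N - 1) - 1) = 1 - T ^ (N - 1)"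
    by (simp add: T_def algebra_simps)
  also have "\<dots> \<le> 0"
    using T by simp
  finally have "F T \<le> 0" .
  moreover have "continuous_on {1..T} F"
    unfolding F_def by (intro continuous_intros)
  ultimately obtain t where "1 \<le> t" "F t = 0"
    using IVT2'[of F T 0 1] F1 T by auto
  then show False
    using F1 root[of t] by auto
qed

text \<open>If the conclusion fails, the two remaining pairs have sign minus, and the sign change
  occurs between 0 and 1.\<close>

lemma no_eigenvalue_less_1:
  assumes "Q u\<^sub>1 = Q v\<^sub>1 \<or> Q u\<^sub>2 = Q v\<^sub>2"
  shows "Q u\<^sub>1 = Q v\<^sub>2 \<or> Q u\<^sub>2 = Q v\<^sub>1"
proof (rule ccontr)
  assume neg: "\<not> ?thesis"
  obtain N where N: "\<sigma> ^^ N = id" "0 < N"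
    using perm by (rule permutation_is_nilpotent)
  define F where "F t = visits \<sigma> N v\<^sub>1 u\<^sub>1 t + visits \<sigma> N v\<^sub>2 u\<^sub>2 t + (t ^ N - 1)" for t
  have root: "t = 1" if "0 < t" "F t = 0" for t
    using that neg eigenvalue_eq_1[OF N \<open>0 < t\<close>]
    by (simp add: F_def visits_eq_0 perm in_orbit_iff)
  have "0 < visits \<sigma> N v\<^sub>1 u\<^sub>1 1 + visits \<sigma> N v\<^sub>2 u\<^sub>2 1"
    using assms visits_at_1_pos[OF N] visits_nonneg[of 1 \<sigma> N]
    by (metis add_nonneg_pos add_pos_nonneg in_orbit_iff zero_le_one)
  then have F1: "0 < F 1"
    by (simp add: F_def)
  \<comment> \<open>By \<open>not_arcs\<close> the visit terms vanish at 0, so the value is -1.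
    Hence the root found below is positive, as \<open>root\<close> requires.\<close>
  have F0: "F 0 < 0"
    using N not_arcs by (simp add: F_def visits_at_0 zero_power)
  moreover have "continuous_on {0..1} F"
    unfolding F_def by (intro continuous_intros)
  ultimately obtain t where "0 \<le> t" "t \<le> 1" "F t = 0"
    using IVT'[of F 0 0 1] F1 by auto
  then show False
    using F0 F1 root[of t] by (cases "t = 0") auto
qed

text \<open>If the four orbits are distinct, then \<open>L\<close> has a Jordan block for the eigenvalue 1: the
  total mass on the orbit of \<open>u\<^sub>1\<close> grows linearly along the iterates of the indicator
  of the orbit of \<open>v\<^sub>2\<close>.\<close>

lemma not_all_distinct_orbits:
  "\<not> distinct [Q u\<^sub>1, Q u\<^sub>2, Q v\<^sub>1, Q v\<^sub>2]"
proof
  assume neq: "distinct [Q u\<^sub>1, Q u\<^sub>2, Q v\<^sub>1, Q v\<^sub>2]"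
  define z where "z = (\<lambda>x. of_bool (x \<in> Q v\<^sub>2) :: real)"
  have \<sigma>Q: "\<sigma> x \<in> Q y \<longleftrightarrow> x \<in> Q y" for x y
    by (simp add: in_orbit_iff permutation_orbit_step perm)
  have fin: "finite (Q u\<^sub>1)"
    by (simp add: finite_orbit in_orbit_iff)
  have inj: "inj_on \<sigma> (Q u\<^sub>1)"
    using perm by (meson bij_is_inj inj_on_subset permutation_bijective subset_UNIV)
  have "\<sigma> ` Q u\<^sub>1 = Q u\<^sub>1"
    by (rule endo_inj_surj[OF fin _ inj]) (auto simp: \<sigma>Q)
  then have sum_\<sigma>: "(\<Sum>x\<in>Q u\<^sub>1. f (\<sigma> x)) = (\<Sum>x\<in>Q u\<^sub>1. f x)" for f :: "'v \<Rightarrow> real"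
    using sum.reindex[OF inj, of f] by simp
  \<comment> \<open>The perturbation only affects the orbits of \<open>u\<^sub>1\<close> and
    \<open>u\<^sub>2\<close>. So the values at \<open>v\<^sub>2\<close> and \<open>v\<^sub>1\<close>
    stay 1 and 0, and every step adds 1 to the mass on the orbit of
    \<open>u\<^sub>1\<close>.\<close>
  have inv: "(\<forall>x. x \<notin> Q u\<^sub>1 \<union> Q u\<^sub>2 \<longrightarrow> (L ^^ k) z x = z x) \<and> (\<Sum>x\<in>Q u\<^sub>1. (L ^^ k) z x) = k" for k
  proof (induction k)
    case 0
    have "z x = 0" if "x \<in> Q u\<^sub>1" for x
      using that neq by (auto simp: z_def in_orbit_iff)
    then show ?case
      by simp
  next
    case (Suc k)
    let ?w = "(L ^^ k) z"
    have "?w v\<^sub>2 - ?w v\<^sub>1 = 1"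
      using Suc neq by (auto simp: z_def in_orbit_iff)
    then have L: "L ?w x = ?w (\<sigma> x) + (of_bool (x = u\<^sub>1) - of_bool (x = u\<^sub>2))" for x
      by (simp add: pt_op_def)
    have "(\<Sum>x\<in>Q u\<^sub>1. of_bool (x = u\<^sub>1) - of_bool (x = u\<^sub>2) :: real) = (\<Sum>x\<in>Q u\<^sub>1. of_bool (x = u\<^sub>1))"
      using neq by (intro sum.cong) (auto simp: in_orbit_iff)
    also have "\<dots> = 1"
      using fin by (simp add: of_bool_def in_orbit_iff)
    finally have "(\<Sum>x\<in>Q u\<^sub>1. L ?w x) = Suc k"
      using Suc sum_\<sigma>[of ?w] by (simp add: L sum.distrib)
    moreover have "L ?w x = z x" if "x \<notin> Q u\<^sub>1 \<union> Q u\<^sub>2" for x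
    proof -
      have "x \<noteq> u\<^sub>1" "x \<noteq> u\<^sub>2" "\<sigma> x \<notin> Q u\<^sub>1 \<union> Q u\<^sub>2"
        using that \<sigma>Q by (auto simp: in_orbit_iff)
      then show ?thesis
        using Suc by (simp add: L) (simp add: z_def \<sigma>Q)
    qed
    ultimately show ?case
      by simp
  qed
  show False
    using inv[of K] inv[of 0] K by simp
qed

end

section \<open>Cycles of the digraph of a permutation\<close>

text \<open>Arcs are selected by their tails alone: for an orbit \<open>S\<close> of the permutation
  the heads lie in \<open>S\<close> as well. The vertex set is \<open>S\<close> itself, so distinct
  sets give distinct digraphs.\<close>

definition restrict_tails :: "('v, 'a) pre_digraph \<Rightarrow> 'v set \<Rightarrow> ('v, 'a) pre_digraph" where
  "restrict_tails H S = \<lparr>verts = S, arcs = {e \<in> arcs H. tail H e \<in> S}, tail = tail H, head = head H\<rparr>"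

lemma restrict_tails_simps [simp]:
  "verts (restrict_tails H S) = S"
  "arcs (restrict_tails H S) = {e \<in> arcs H. tail H e \<in> S}"
  "tail (restrict_tails H S) = tail H"
  "head (restrict_tails H S) = head H"
  by (simp_all add: restrict_tails_def)

lemma (in pre_digraph) cas_append_single:
  "cas u (p @ [e]) w \<longleftrightarrow> cas u p (tail G e) \<and> head G e = w"
  by (induction p arbitrary: u) auto

lemma (in pre_digraph) cas_map_upt:
  assumes "\<And>i. i < m \<Longrightarrow> tail G (f i) = g i \<and> head G (f i) = g (Suc i)"
  shows "cas (g 0) (map f [0..<m]) (g m)"
  using assms by (induction m) (auto simp: cas_append_single simp del: cas_append_iff)

locale perm_digraph =
  fixes H :: "('v, 'a) pre_digraph" and \<sigma> :: "'v \<Rightarrow> 'v"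
  assumes finite_verts: "finite (verts H)"
    and permutes: "\<sigma> permutes verts H"
    and bij_tail: "bij_betw (tail H) (arcs H) (verts H)"
    and head: "e \<in> arcs H \<Longrightarrow> head H e = \<sigma> (tail H e)"
begin

abbreviation "Q \<equiv> orbit \<sigma>"

lemma permutation: "permutation \<sigma>"
  using finite_verts permutes by (auto simp: permutation_permutes)

lemmas in_orbit_iff = permutation_in_orbit_iff[OF permutation]

lemma tail_in_verts: "e \<in> arcs H \<Longrightarrow> tail H e \<in> verts H"
  using bij_tail by (auto simp: bij_betw_def)

lemma orbit_subset_verts: "x \<in> verts H \<Longrightarrow> Q x \<subseteq> verts H"
  by (rule permutes_orbit_subset[OF permutes])

lemma wf_digraph_H: "wf_digraph H"
  using head tail_in_verts permutes_in_image[OF permutes] by unfold_locales auto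

lemma wf_restrict_tails_orbit: "wf_digraph (restrict_tails H (Q x))"
  by unfold_locales (auto simp: head orbit.step)

lemma subgraph_restrict_tails_orbit: "x \<in> verts H \<Longrightarrow> subgraph (restrict_tails H (Q x)) H"
  using orbit_subset_verts wf_digraph_H wf_restrict_tails_orbit
  by (auto simp: subgraph_def compatible_def)

text \<open>The cycle follows \<open>\<sigma>\<close> from \<open>x\<close> until the first return.
  The return time \<open>m\<close> is at least 1, so a fixed point yields a loop and not the empty
  walk.\<close>

lemma directed_cycle_restrict_tails_orbit:
  assumes x: "x \<in> verts H"
  shows "directed_cycle (restrict_tails H (Q x))"
proof -
  let ?C = "restrict_tails H (Q x)"
  interpret C: wf_digraph ?C
    by (rule wf_restrict_tails_orbit)
  define \<alpha> where "\<alpha> = inv_into (arcs H) (tail H)"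
  have tail_\<alpha>: "tail H (\<alpha> y) = y" and \<alpha>_arcs: "\<alpha> y \<in> arcs H" if "y \<in> verts H" for y
    using that bij_tail unfolding \<alpha>_def bij_betw_def
    by (auto intro: f_inv_into_f inv_into_into)
  define m where "m = funpow_dist1 \<sigma> x x"
  define g where "g i = (\<sigma> ^^ i) x" for i
  define p where "p = map (\<lambda>i. \<alpha> (g i)) [0..<m]"
  have x_orbit: "x \<in> Q x"
    by (simp add: in_orbit_iff)
  have g_orbit: "g i \<in> Q x" for i
    using x_orbit unfolding g_def by (rule funpow_in_orbit)
  then have g_verts: "g i \<in> verts H" for i
    using orbit_subset_verts[OF x] by blast
  have orbit: "Q x = g ` {0..<m}"
    unfolding g_def m_def using x_orbit by (rule orbit_conv_funpow_dist1)
  have gm: "g 0 = x" "g m = x"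
    unfolding g_def m_def using funpow_dist1_prop[OF x_orbit] by simp_all
  have tail_p: "map (tail H) p = map g [0..<m]"
    by (simp add: p_def tail_\<alpha> g_verts)
  have head_p: "map (head H) p = map \<sigma> (map g [0..<m])"
    by (simp add: p_def tail_\<alpha> \<alpha>_arcs g_verts head)
  have "inj_on g {0..<m}"
    unfolding g_def m_def using x_orbit by (rule inj_on_funpow_dist1)
  \<comment> \<open>\<open>cycle\<close> asks for distinctness of the vertices after the first one,
    which are the heads of the arcs.\<close>
  then have "distinct (map (head H) p)"
    unfolding head_p by (simp add: distinct_map comp_inj_on permutes_inj_on[OF permutes])
  moreover have cas: "C.cas x p x"
    using C.cas_map_upt[of m "\<lambda>i. \<alpha> (g i)" g]
    by (simp add: p_def gm tail_\<alpha> \<alpha>_arcs g_verts head) (simp add: g_def)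
  moreover have "p \<noteq> []"
    by (simp add: p_def m_def)
  moreover have set_p: "set p = arcs ?C"
  proof -
    have "set p = \<alpha> ` Q x"
      unfolding orbit by (auto simp: p_def)
    also have "\<dots> = {e \<in> arcs H. tail H e \<in> Q x}"
    proof safe
      fix e assume e: "e \<in> arcs H" "tail H e \<in> Q x"
      then have "\<alpha> (tail H e) = e"
        unfolding \<alpha>_def using bij_tail by (simp add: bij_betw_def)
      then show "e \<in> \<alpha> ` Q x"
        using e(2) by (metis imageI)
    qed (use orbit_subset_verts[OF x] \<alpha>_arcs tail_\<alpha> in auto)
    finally show ?thesis
      by simp
  qed
  ultimately have "C.cycle p"
    unfolding C.cycle_def C.awalk_def
    using x_orbit by (intro exI[of _ x]) (simp add: C.awalk_verts_conv')
  moreover have "verts ?C = tail ?C ` set p"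
    using arg_cong[OF tail_p, of set] orbit by simp
  ultimately show ?thesis
    unfolding directed_cycle_def using set_p by metis
qed

lemma consists_of_orbits:
  "consists_of_disjoint_cycles H (restrict_tails H ` Q ` verts H)"
proof -
  have "x \<in> Q x" for x
    by (simp add: in_orbit_iff)
  then show ?thesis
    unfolding consists_of_disjoint_cycles_def
    using orbit_subset_verts subgraph_restrict_tails_orbit directed_cycle_restrict_tails_orbit
      tail_in_verts
    by (fastforce simp: pairwise_def in_orbit_iff)
qed

text \<open>Heads are the images of tails under the bijection \<open>\<sigma>\<close>, so every
  vertex is also the head of exactly one arc. This makes the results on orbits available for the
  reverse.\<close>

lemma perm_digraph_reverse: "perm_digraph (reverse_digraph H) (inv_into UNIV \<sigma>)"
proof
  have "bij_betw (\<sigma> \<circ> tail H) (arcs H) (verts H)"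
    using bij_tail permutes_imp_bij[OF permutes] by (rule bij_betw_trans)
  then have "bij_betw (head H) (arcs H) (verts H)"
    by (subst bij_betw_cong[of _ _ "\<sigma> \<circ> tail H"]) (simp_all add: head)
  then show "bij_betw (tail (reverse_digraph H)) (arcs (reverse_digraph H)) (verts (reverse_digraph H))"
    by (simp add: reverse_digraph_def)
qed (simp_all add: reverse_digraph_def finite_verts permutes_inv permutes head permutes_inverses[OF permutes])

end

section \<open>From coincidences of orbits to the listed types\<close>

text \<open>Here \<open>a\<^sub>i\<close> is the cycle of the tail \<open>u\<^sub>i\<close> and \<open>b\<^sub>i\<close> that of the head \<open>v\<^sub>i\<close>. The first disjunct comprises
  types 1 and 2(c), the second one types 1 and 2(d).\<close>

definition listed_pattern :: "'b \<Rightarrow> 'b \<Rightarrow> 'b \<Rightarrow> 'b \<Rightarrow> bool" where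
  "listed_pattern a\<^sub>1 a\<^sub>2 b\<^sub>1 b\<^sub>2 \<longleftrightarrow>
     a\<^sub>1 = a\<^sub>2 \<and> b\<^sub>1 = b\<^sub>2 \<or>
     b\<^sub>1 = b\<^sub>2 \<and> (a\<^sub>1 = b\<^sub>1 \<or> a\<^sub>2 = b\<^sub>1) \<or>
     a\<^sub>1 = a\<^sub>2 \<and> distinct [a\<^sub>1, b\<^sub>1, b\<^sub>2]"

text \<open>If a tail and a head share a cycle, the first two hypotheses put both heads on the cycle
  of one tail or both tails on the cycle of one head. Otherwise, by the third, the two tails or the
  two heads share a cycle. Reversal exchanges the roles of tails and heads.\<close>

lemma listed_patternI:
  assumes "a\<^sub>1 = b\<^sub>2 \<or> a\<^sub>2 = b\<^sub>1 \<Longrightarrow> a\<^sub>1 = b\<^sub>1 \<or> a\<^sub>2 = b\<^sub>2"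
    and "a\<^sub>1 = b\<^sub>1 \<or> a\<^sub>2 = b\<^sub>2 \<Longrightarrow> a\<^sub>1 = b\<^sub>2 \<or> a\<^sub>2 = b\<^sub>1"
    and "\<not> distinct [a\<^sub>1, a\<^sub>2, b\<^sub>1, b\<^sub>2]"
  shows "listed_pattern a\<^sub>1 a\<^sub>2 b\<^sub>1 b\<^sub>2 \<or> listed_pattern b\<^sub>1 b\<^sub>2 a\<^sub>1 a\<^sub>2"
  using assms unfolding listed_pattern_def distinct.simps list.set insert_iff empty_iff by metis

text \<open>By \<open>cover\<close> the cycles of \<open>H\<close> are those through the four
  vertices, so \<open>pattern\<close> determines their number and the vertices on them.\<close>

lemma (in perm_digraph) of_listed_type_orbits:
  assumes H: "H = P_subgraph G c u\<^sub>1 v\<^sub>1 u\<^sub>2 v\<^sub>2"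
    and pattern: "listed_pattern (Q u\<^sub>1) (Q u\<^sub>2) (Q v\<^sub>1) (Q v\<^sub>2)"
    and cover: "Q ` verts H = {Q u\<^sub>1, Q u\<^sub>2, Q v\<^sub>1, Q v\<^sub>2}"
    and neq: "u\<^sub>1 \<noteq> u\<^sub>2" "v\<^sub>1 \<noteq> v\<^sub>2"
  shows "of_listed_type G c u\<^sub>1 v\<^sub>1 u\<^sub>2 v\<^sub>2"
proof -
  let ?R = "restrict_tails H"
  have R_eq: "?R S = ?R S' \<longleftrightarrow> S = S'" for S S'
    by (metis restrict_tails_simps(1))
  have consists: "consists_of_disjoint_cycles H (?R ` {Q u\<^sub>1, Q u\<^sub>2, Q v\<^sub>1, Q v\<^sub>2})"
    using consists_of_orbits by (simp only: cover)
  have type_2dI: "type_2d H x\<^sub>1 x\<^sub>2 y\<^sub>1 y\<^sub>2"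
    if "Q y\<^sub>1 = Q x\<^sub>2" "Q y\<^sub>2 = Q x\<^sub>2" "Q x\<^sub>1 \<noteq> Q x\<^sub>2" "{x\<^sub>1, x\<^sub>2} = {u\<^sub>1, u\<^sub>2}" "{y\<^sub>1, y\<^sub>2} = {v\<^sub>1, v\<^sub>2}"
      "y\<^sub>1 \<noteq> x\<^sub>2" for x\<^sub>1 x\<^sub>2 y\<^sub>1 y\<^sub>2
  proof -
    have "{Q u\<^sub>1, Q u\<^sub>2, Q v\<^sub>1, Q v\<^sub>2} = Q ` ({x\<^sub>1, x\<^sub>2} \<union> {y\<^sub>1, y\<^sub>2})"
      unfolding that(4,5) by auto
    then have "consists_of_disjoint_cycles H {?R (Q x\<^sub>1), ?R (Q x\<^sub>2)}"
      using consists that(1,2) by (simp add: insert_commute)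
    moreover have "x\<^sub>1 \<in> verts (?R (Q x\<^sub>1))" "x\<^sub>2 \<in> verts (?R (Q x\<^sub>2))"
        "y\<^sub>1 \<in> verts (?R (Q x\<^sub>2))" "y\<^sub>2 \<in> verts (?R (Q x\<^sub>2))" "?R (Q x\<^sub>1) \<noteq> ?R (Q x\<^sub>2)"
      using that(1-3) by (simp_all add: in_orbit_iff R_eq)
    ultimately show ?thesis
      unfolding type_2d_def using that(6) by blast
  qed
  \<comment> \<open>As \<open>v\<^sub>1 \<noteq> v\<^sub>2\<close>, at least one head differs from
    \<open>x\<^sub>2\<close>; it is numbered first.\<close>
  have type_2d: "\<exists>y\<^sub>1 y\<^sub>2. {y\<^sub>1, y\<^sub>2} = {v\<^sub>1, v\<^sub>2} \<and> type_2d H x\<^sub>1 x\<^sub>2 y\<^sub>1 y\<^sub>2"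
    if "Q v\<^sub>1 = Q x\<^sub>2" "Q v\<^sub>2 = Q x\<^sub>2" "Q x\<^sub>1 \<noteq> Q x\<^sub>2" "{x\<^sub>1, x\<^sub>2} = {u\<^sub>1, u\<^sub>2}" for x\<^sub>1 x\<^sub>2
    using that neq(2) type_2dI[of v\<^sub>1 x\<^sub>2 v\<^sub>2 x\<^sub>1] type_2dI[of v\<^sub>2 x\<^sub>2 v\<^sub>1 x\<^sub>1] by (metis insert_commute)
  consider
      (1) "Q u\<^sub>1 = Q u\<^sub>2" "Q v\<^sub>1 = Q u\<^sub>2" "Q v\<^sub>2 = Q u\<^sub>2"
    | (2) "Q u\<^sub>1 = Q u\<^sub>2" "Q v\<^sub>1 = Q v\<^sub>2" "Q u\<^sub>1 \<noteq> Q v\<^sub>1"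
    | (3) "Q v\<^sub>1 = Q u\<^sub>2" "Q v\<^sub>2 = Q u\<^sub>2" "Q u\<^sub>1 \<noteq> Q u\<^sub>2"
    | (4) "Q v\<^sub>1 = Q u\<^sub>1" "Q v\<^sub>2 = Q u\<^sub>1" "Q u\<^sub>2 \<noteq> Q u\<^sub>1"
    | (5) "Q u\<^sub>1 = Q u\<^sub>2" "distinct [Q u\<^sub>1, Q v\<^sub>1, Q v\<^sub>2]"
    using pattern unfolding listed_pattern_def by metis
  then show ?thesis
  proof cases
    case 1
    then have "consists_of_disjoint_cycles H {?R (Q u\<^sub>1)}"
      using consists by simp
    then have "H = ?R (Q u\<^sub>1)" "directed_cycle (?R (Q u\<^sub>1))"
      by (auto simp: consists_of_disjoint_cycles_def intro!: pre_digraph.equality)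
    then have "type_1 H"
      by (simp add: type_1_def)
    then show ?thesis
      unfolding of_listed_type_def H Let_def by blast
  next
    case 2
    then have "consists_of_disjoint_cycles H {?R (Q u\<^sub>1), ?R (Q v\<^sub>1)}"
      using consists by simp
    moreover have "u\<^sub>1 \<in> verts (?R (Q u\<^sub>1))" "u\<^sub>2 \<in> verts (?R (Q u\<^sub>1))"
        "v\<^sub>1 \<in> verts (?R (Q v\<^sub>1))" "v\<^sub>2 \<in> verts (?R (Q v\<^sub>1))" "?R (Q u\<^sub>1) \<noteq> ?R (Q v\<^sub>1)"
      using 2 by (simp_all add: in_orbit_iff R_eq)
    moreover have "distinct [u\<^sub>1, u\<^sub>2, v\<^sub>1, v\<^sub>2]"
      using 2 neq by auto
    ultimately have "type_2c H u\<^sub>1 u\<^sub>2 v\<^sub>1 v\<^sub>2"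
      unfolding type_2c_def by blast
    then show ?thesis
      unfolding of_listed_type_def H Let_def by blast
  next
    case 3
    then show ?thesis
      using type_2d[of u\<^sub>2 u\<^sub>1] unfolding of_listed_type_def H Let_def by blast
  next
    case 4
    then show ?thesis
      using type_2d[of u\<^sub>1 u\<^sub>2] unfolding of_listed_type_def H Let_def by blast
  next
    case 5
    then have "consists_of_disjoint_cycles H {?R (Q u\<^sub>1), ?R (Q v\<^sub>1), ?R (Q v\<^sub>2)}"
      using consists by simp
    moreover have "u\<^sub>1 \<in> verts (?R (Q u\<^sub>1))" "u\<^sub>2 \<in> verts (?R (Q u\<^sub>1))"
        "v\<^sub>1 \<in> verts (?R (Q v\<^sub>1))" "v\<^sub>2 \<in> verts (?R (Q v\<^sub>2))"
        "distinct [?R (Q u\<^sub>1), ?R (Q v\<^sub>1), ?R (Q v\<^sub>2)]"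
      using 5 by (simp_all add: in_orbit_iff R_eq)
    moreover have "distinct [u\<^sub>1, u\<^sub>2, v\<^sub>1, v\<^sub>2]"
      using 5 neq by auto
    ultimately have "type_3c H u\<^sub>1 u\<^sub>2 v\<^sub>1 v\<^sub>2"
      unfolding type_3c_def by blast
    then show ?thesis
      unfolding of_listed_type_def H Let_def by blast
  qed
qed

section \<open>Reversal and weak connectedness\<close>

lemma P_subgraph_reverse:
  "P_subgraph (reverse_digraph G) c v\<^sub>1 u\<^sub>1 v\<^sub>2 u\<^sub>2 = reverse_digraph (P_subgraph G c u\<^sub>1 v\<^sub>1 u\<^sub>2 v\<^sub>2)"
  by (auto simp: P_subgraph_def reverse_digraph_def T_subgraph_def arcs_between_def arc_to_ends_def)

text \<open>Weak connectedness is reachability in the symmetric closure, and membership in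
  \<open>S\<close> is invariant along its paths. The set of interest is a cycle of \<open>P\<close>
  that misses the four vertices.\<close>

lemma connected_closed_set:
  assumes "Digraph_Component.connected G"
    and closed: "\<And>e. e \<in> arcs G \<Longrightarrow> tail G e \<in> S \<longleftrightarrow> head G e \<in> S"
    and "x \<in> verts G" "x \<in> S" "y \<in> verts G"
  shows "y \<in> S"
proof -
  have "x \<rightarrow>\<^sup>*\<^bsub>with_proj (mk_symmetric G)\<^esub> y"
    using assms by (simp add: connected_def strongly_connected_def)
  then have "(x, y) \<in> rtrancl_on (verts G) (parcs (mk_symmetric G))"
    by (simp add: reachable_def)
  then show ?thesis
    using \<open>x \<in> S\<close> closed by induction (auto simp: parcs_mk_symmetric)
qed

section \<open>From PT-matrices to permutations and operators\<close>

text \<open>The integer kernel of \<open>pt_op\<close>, polymorphic so that it serves for matrix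
  indices and for vertices.\<close>

definition pt_entry :: "('v \<Rightarrow> 'v) \<Rightarrow> 'v \<Rightarrow> 'v \<Rightarrow> 'v \<Rightarrow> 'v \<Rightarrow> 'v \<Rightarrow> 'v \<Rightarrow> int" where
  "pt_entry \<sigma> u\<^sub>1 v\<^sub>1 u\<^sub>2 v\<^sub>2 x y = of_bool (y = \<sigma> x) +
     (of_bool (x = u\<^sub>1) - of_bool (x = u\<^sub>2)) * (of_bool (y = v\<^sub>2) - of_bool (y = v\<^sub>1))"

text \<open>The entries \<open>- 1\<close> of \<open>T_block\<close> are at
  \<open>(i\<^sub>1, j\<^sub>2)\<close> and \<open>(i\<^sub>2, j\<^sub>1)\<close>, hence the
  exchange of \<open>j\<^sub>1\<close> and \<open>j\<^sub>2\<close> in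
  \<open>pt_entry\<close>.\<close>

lemma is_PT_matE:
  assumes "is_PT_mat n A"
  obtains \<pi> i\<^sub>1 j\<^sub>1 i\<^sub>2 j\<^sub>2 where "\<pi> permutes {..<n}"
    and "i\<^sub>1 < n" "j\<^sub>1 < n" "i\<^sub>2 < n" "j\<^sub>2 < n" "i\<^sub>1 \<noteq> i\<^sub>2" "j\<^sub>1 \<noteq> j\<^sub>2"
    and "\<And>i j. i < n \<Longrightarrow> j < n \<Longrightarrow> A $$ (i, j) = pt_entry \<pi> i\<^sub>1 j\<^sub>2 i\<^sub>2 j\<^sub>1 i j"
proof -
  obtain \<pi> i\<^sub>1 j\<^sub>1 i\<^sub>2 j\<^sub>2 where A: "A = mat n n (\<lambda>(i, j). if j = \<pi> i then 1 else 0) + T_block n i\<^sub>1 j\<^sub>1 i\<^sub>2 j\<^sub>2"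
    and *: "\<pi> permutes {..<n}" "i\<^sub>1 < n" "j\<^sub>1 < n" "i\<^sub>2 < n" "j\<^sub>2 < n" "i\<^sub>1 \<noteq> i\<^sub>2" "j\<^sub>1 \<noteq> j\<^sub>2"
    using assms unfolding is_PT_mat_def is_permutation_mat_def is_T_block_def by blast
  have "A $$ (i, j) = pt_entry \<pi> i\<^sub>1 j\<^sub>2 i\<^sub>2 j\<^sub>1 i j" if "i < n" "j < n" for i j
    using that * unfolding A T_block_def pt_entry_def by auto
  with * show thesis
    by (rule that)
qed

lemma pt_entry_ge: "- 1 \<le> pt_entry \<sigma> u\<^sub>1 v\<^sub>1 u\<^sub>2 v\<^sub>2 x y"
  by (simp add: pt_entry_def of_bool_def)

lemma card_arcs_between_pt_entry:
  assumes corr: "corresponding_mat \<Gamma> c vs A" and xy: "x \<in> verts \<Gamma>" "y \<in> verts \<Gamma>"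
    and entry: "\<And>i j. i < length vs \<Longrightarrow> j < length vs \<Longrightarrow>
      A $$ (i, j) = pt_entry \<sigma> u\<^sub>1 v\<^sub>1 u\<^sub>2 v\<^sub>2 (vs ! i) (vs ! j)"
  shows "card (arcs_between \<Gamma> c Blue x y) = nat (pt_entry \<sigma> u\<^sub>1 v\<^sub>1 u\<^sub>2 v\<^sub>2 x y)"
    and "card (arcs_between \<Gamma> c Red x y) = nat (- pt_entry \<sigma> u\<^sub>1 v\<^sub>1 u\<^sub>2 v\<^sub>2 x y)"
proof -
  have "set vs = verts \<Gamma>"
    using corr by (simp add: corresponding_mat_def)
  then obtain i j where "i < length vs" "j < length vs" "x = vs ! i" "y = vs ! j"
    using xy by (metis in_set_conv_nth)
  then show "card (arcs_between \<Gamma> c Blue x y) = nat (pt_entry \<sigma> u\<^sub>1 v\<^sub>1 u\<^sub>2 v\<^sub>2 x y)"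
    "card (arcs_between \<Gamma> c Red x y) = nat (- pt_entry \<sigma> u\<^sub>1 v\<^sub>1 u\<^sub>2 v\<^sub>2 x y)"
    using corr by (simp_all add: corresponding_mat_def entry)
qed

lemma pt_entry_swap: "pt_entry \<sigma> u\<^sub>2 v\<^sub>2 u\<^sub>1 v\<^sub>1 = pt_entry \<sigma> u\<^sub>1 v\<^sub>1 u\<^sub>2 v\<^sub>2"
  by (simp add: pt_entry_def fun_eq_iff algebra_simps)

text \<open>Negative entries occur only where the T-block has \<open>- 1\<close>, so the two red
  arcs determine the block, up to their numbering.\<close>

lemma PT_graphE:
  assumes PT: "PT_graph \<Gamma> c" and red: "exactly_two_red_arcs \<Gamma> c u\<^sub>1 v\<^sub>1 u\<^sub>2 v\<^sub>2"
    and blue: "no_multiple_blue_arcs \<Gamma> c"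
  obtains \<sigma> vs A where "corresponding_mat \<Gamma> c vs A" and "\<sigma> permutes verts \<Gamma>"
    and "u\<^sub>1 \<in> verts \<Gamma>" "v\<^sub>1 \<in> verts \<Gamma>" "u\<^sub>2 \<in> verts \<Gamma>" "v\<^sub>2 \<in> verts \<Gamma>" "u\<^sub>1 \<noteq> u\<^sub>2" "v\<^sub>1 \<noteq> v\<^sub>2"
    and "\<sigma> u\<^sub>1 \<notin> {v\<^sub>1, v\<^sub>2}" "\<sigma> u\<^sub>2 \<notin> {v\<^sub>1, v\<^sub>2}"
    and "\<And>i j. i < length vs \<Longrightarrow> j < length vs \<Longrightarrow>
      A $$ (i, j) = pt_entry \<sigma> u\<^sub>1 v\<^sub>1 u\<^sub>2 v\<^sub>2 (vs ! i) (vs ! j)"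
proof -
  interpret fin_digraph \<Gamma>
    using PT by (simp add: PT_graph_def)
  obtain vs A where A: "is_PT_mat (length vs) A" and corr: "corresponding_mat \<Gamma> c vs A"
    using PT by (auto simp: PT_graph_def)
  define n where "n = length vs"
  have vs: "distinct vs" "set vs = verts \<Gamma>"
    using corr by (simp_all add: corresponding_mat_def)
  obtain \<pi> i\<^sub>1 j\<^sub>1 i\<^sub>2 j\<^sub>2 where \<pi>: "\<pi> permutes {..<n}"
    and lt: "i\<^sub>1 < n" "j\<^sub>1 < n" "i\<^sub>2 < n" "j\<^sub>2 < n" and ne: "i\<^sub>1 \<noteq> i\<^sub>2" "j\<^sub>1 \<noteq> j\<^sub>2"
    and entry: "\<And>i j. i < n \<Longrightarrow> j < n \<Longrightarrow> A $$ (i, j) = pt_entry \<pi> i\<^sub>1 j\<^sub>2 i\<^sub>2 j\<^sub>1 i j"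
    using A unfolding n_def by (elim is_PT_matE) blast
  have nth_eq: "vs ! i = vs ! j \<longleftrightarrow> i = j" if "i < n" "j < n" for i j
    using that vs(1) by (simp add: nth_eq_iff_index_eq n_def)
  have bij: "bij_betw ((!) vs) {..<n} (verts \<Gamma>)"
    using bij_betw_nth[OF vs(1), of "{..<n}"] vs(2) by (simp add: n_def)
  \<comment> \<open>\<open>\<pi>\<close> is carried from indices to vertices along
    \<open>vs\<close>, and extended by the identity as \<open>permutes\<close> demands.\<close>
  define \<sigma> where "\<sigma> x = (if x \<in> verts \<Gamma> then vs ! \<pi> (inv_into {..<n} ((!) vs) x) else x)" for x
  have \<sigma>: "\<sigma> permutes verts \<Gamma>"
    unfolding \<sigma>_def using permutes_bij_inv_into[OF \<pi> bij] .
  have \<pi>_lt: "\<pi> i < n" if "i < n" for i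
    using permutes_in_image[OF \<pi>] that by auto
  have \<sigma>_nth: "\<sigma> (vs ! i) = vs ! \<pi> i" if "i < n" for i
    using that bij vs(2) unfolding \<sigma>_def
    by (auto simp: bij_betw_def n_def inv_into_f_f)
  define w\<^sub>1 x\<^sub>1 w\<^sub>2 x\<^sub>2 where wx: "w\<^sub>1 = vs ! i\<^sub>1" "x\<^sub>1 = vs ! j\<^sub>2" "w\<^sub>2 = vs ! i\<^sub>2" "x\<^sub>2 = vs ! j\<^sub>1"
  have wx_ne: "w\<^sub>1 \<noteq> w\<^sub>2" "x\<^sub>1 \<noteq> x\<^sub>2"
    using lt ne by (simp_all add: wx nth_eq)
  have entry': "A $$ (i, j) = pt_entry \<sigma> w\<^sub>1 x\<^sub>1 w\<^sub>2 x\<^sub>2 (vs ! i) (vs ! j)" if "i < n" "j < n" for i j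
    using that lt \<pi>_lt by (simp add: entry pt_entry_def wx nth_eq \<sigma>_nth)
  let ?E = "pt_entry \<sigma> w\<^sub>1 x\<^sub>1 w\<^sub>2 x\<^sub>2"
  note card = card_arcs_between_pt_entry[OF corr _ _ entry'[unfolded n_def]]
  have fin: "finite (arcs_between \<Gamma> c k x y)" for k x y
    by (simp add: arcs_between_def)
  obtain r\<^sub>1 r\<^sub>2 where r: "r\<^sub>1 \<noteq> r\<^sub>2" "r\<^sub>1 \<in> arcs_between \<Gamma> c Red u\<^sub>1 v\<^sub>1" "r\<^sub>2 \<in> arcs_between \<Gamma> c Red u\<^sub>2 v\<^sub>2"
    using red unfolding exactly_two_red_arcs_def arcs_between_def by blast
  have verts: "u\<^sub>1 \<in> verts \<Gamma>" "v\<^sub>1 \<in> verts \<Gamma>" "u\<^sub>2 \<in> verts \<Gamma>" "v\<^sub>2 \<in> verts \<Gamma>"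
    using r(2,3) by (auto simp: arcs_between_def arc_to_ends_def)
  have red_neg: "?E u\<^sub>1 v\<^sub>1 < 0" "?E u\<^sub>2 v\<^sub>2 < 0"
    using card(2)[OF verts(1,2)] card(2)[OF verts(3,4)] r(2,3) fin card_gt_0_iff
    by (metis empty_iff nat_0_iff neg_le_0_iff_le not_le not_gr0)+
  \<comment> \<open>Two red arcs with the same ends would need an entry below
    \<open>- 1\<close>.\<close>
  have "(u\<^sub>1, v\<^sub>1) \<noteq> (u\<^sub>2, v\<^sub>2)"
  proof
    assume "(u\<^sub>1, v\<^sub>1) = (u\<^sub>2, v\<^sub>2)"
    then have "{r\<^sub>1, r\<^sub>2} \<subseteq> arcs_between \<Gamma> c Red u\<^sub>1 v\<^sub>1"
      using r by auto
    then have "card {r\<^sub>1, r\<^sub>2} \<le> nat (- ?E u\<^sub>1 v\<^sub>1)"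
      using card_mono[OF fin] card(2)[OF verts(1,2)] by metis
    then show False
      using r(1) pt_entry_ge[of \<sigma> w\<^sub>1 x\<^sub>1 w\<^sub>2 x\<^sub>2 u\<^sub>1 v\<^sub>1] by simp
  qed
  moreover have neg: "(x, y) = (w\<^sub>1, x\<^sub>1) \<or> (x, y) = (w\<^sub>2, x\<^sub>2)" if "?E x y < 0" for x y
    using that wx_ne unfolding pt_entry_def by (auto simp: of_bool_def split: if_splits)
  ultimately have
    "(u\<^sub>1, v\<^sub>1) = (w\<^sub>1, x\<^sub>1) \<and> (u\<^sub>2, v\<^sub>2) = (w\<^sub>2, x\<^sub>2) \<or> (u\<^sub>1, v\<^sub>1) = (w\<^sub>2, x\<^sub>2) \<and> (u\<^sub>2, v\<^sub>2) = (w\<^sub>1, x\<^sub>1)"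
    using neg[OF red_neg(1)] neg[OF red_neg(2)] by metis
  then have E: "?E = pt_entry \<sigma> u\<^sub>1 v\<^sub>1 u\<^sub>2 v\<^sub>2" and uv_ne: "u\<^sub>1 \<noteq> u\<^sub>2" "v\<^sub>1 \<noteq> v\<^sub>2"
    using wx_ne pt_entry_swap by (metis prod.inject)+
  have "card (arcs_between \<Gamma> c Blue x y) \<le> 1" for x y
    using blue by (auto simp: no_multiple_blue_arcs_def arcs_between_def card_le_Suc0_iff_eq)
  then have le_1: "pt_entry \<sigma> u\<^sub>1 v\<^sub>1 u\<^sub>2 v\<^sub>2 x y \<le> 1" if "x \<in> verts \<Gamma>" "y \<in> verts \<Gamma>" for x y
    using card(1)[OF that] by (simp add: E) (metis One_nat_def nat_le_iff of_nat_1)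
  \<comment> \<open>A 1 of \<open>P\<close> at the place of a red arc would cancel the
    \<open>- 1\<close>; at one of the other two corners it would give a 2, a double blue
    arc.\<close>
  have "\<sigma> u\<^sub>1 \<notin> {v\<^sub>1, v\<^sub>2}" "\<sigma> u\<^sub>2 \<notin> {v\<^sub>1, v\<^sub>2}"
    using red_neg le_1[OF verts(1,4)] le_1[OF verts(3,2)] uv_ne
    by (auto simp: E pt_entry_def)
  then show thesis
    using entry' by (intro that[OF corr \<sigma> verts uv_ne]) (simp_all add: E n_def)
qed

text \<open>Transfers the finite order of the matrix to \<open>pt_op\<close>. The last factor of
  \<open>A ^\<^sub>m Suc m\<close> acts on \<open>z\<close> first, hence the induction for arbitrary
  \<open>z\<close>.\<close>

lemma funpow_pt_op_eq_pow_mat: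
  assumes "A \<in> carrier_mat (length vs) (length vs)" and "distinct vs"
    and verts: "\<sigma> permutes set vs" "v\<^sub>1 \<in> set vs" "v\<^sub>2 \<in> set vs"
    and entry: "\<And>i j. i < length vs \<Longrightarrow> j < length vs \<Longrightarrow>
      A $$ (i, j) = pt_entry \<sigma> u\<^sub>1 v\<^sub>1 u\<^sub>2 v\<^sub>2 (vs ! i) (vs ! j)"
    and "i < length vs"
  shows "(pt_op \<sigma> u\<^sub>1 v\<^sub>1 u\<^sub>2 v\<^sub>2 ^^ m) z (vs ! i) =
    (\<Sum>j<length vs. real_of_int ((A ^\<^sub>m m) $$ (i, j)) * z (vs ! j))"
  using \<open>i < length vs\<close>
proof (induction m arbitrary: z)
  case 0
  then have "(\<Sum>j<length vs. real_of_int ((A ^\<^sub>m 0) $$ (i, j)) * z (vs ! j)) =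
      (\<Sum>j<length vs. if i = j then z (vs ! j) else 0)"
    using assms(1) by (intro sum.cong) auto
  also have "\<dots> = z (vs ! i)"
    using 0 by simp
  finally show ?case
    by simp
next
  case (Suc m)
  let ?n = "length vs" and ?L = "pt_op \<sigma> u\<^sub>1 v\<^sub>1 u\<^sub>2 v\<^sub>2"
  have L: "?L z (vs ! j) = (\<Sum>l<?n. real_of_int (A $$ (j, l)) * z (vs ! l))" if j: "j < ?n" for j
  proof -
    have "(\<Sum>l<?n. real_of_int (A $$ (j, l)) * z (vs ! l)) =
        (\<Sum>l<?n. real_of_int (pt_entry \<sigma> u\<^sub>1 v\<^sub>1 u\<^sub>2 v\<^sub>2 (vs ! j) (vs ! l)) * z (vs ! l))"
      using j by (intro sum.cong) (auto simp: entry)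
    also have "\<dots> = (\<Sum>y\<in>set vs. real_of_int (pt_entry \<sigma> u\<^sub>1 v\<^sub>1 u\<^sub>2 v\<^sub>2 (vs ! j) y) * z y)"
      using bij_betw_nth[OF \<open>distinct vs\<close>, of "{..<?n}" "set vs"]
      by (subst sum.reindex_bij_betw[symmetric]) auto
    also have "\<dots> = (\<Sum>y\<in>set vs. of_bool (y = \<sigma> (vs ! j)) * z y) +
       (of_bool (vs ! j = u\<^sub>1) - of_bool (vs ! j = u\<^sub>2)) *
       ((\<Sum>y\<in>set vs. of_bool (y = v\<^sub>2) * z y) - (\<Sum>y\<in>set vs. of_bool (y = v\<^sub>1) * z y))"
      unfolding sum_subtractf[symmetric] sum_distrib_left sum.distrib[symmetric]
      by (intro sum.cong) (simp_all add: pt_entry_def algebra_simps)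
    also have "\<dots> = ?L z (vs ! j)"
      using verts j permutes_in_image[OF verts(1), of "vs ! j"]
      by (simp add: pt_op_def of_bool_def if_distrib[of "\<lambda>a. a * _"] cong: if_cong)
    finally show ?thesis
      by simp
  qed
  have Am: "A ^\<^sub>m m \<in> carrier_mat ?n ?n"
    using assms(1) by simp
  have "(?L ^^ Suc m) z (vs ! i) = (?L ^^ m) (?L z) (vs ! i)"
    by (simp add: funpow_swap1)
  also have "\<dots> = (\<Sum>j<?n. real_of_int ((A ^\<^sub>m m) $$ (i, j)) * ?L z (vs ! j))"
    using Suc by blast
  also have "\<dots> = (\<Sum>j<?n. \<Sum>l<?n. real_of_int ((A ^\<^sub>m m) $$ (i, j) * A $$ (j, l)) * z (vs ! l))"
    by (intro sum.cong) (auto simp: L sum_distrib_left mult.assoc)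
  also have "\<dots> = (\<Sum>l<?n. (\<Sum>j<?n. real_of_int ((A ^\<^sub>m m) $$ (i, j) * A $$ (j, l))) * z (vs ! l))"
    by (subst sum.swap) (simp add: sum_distrib_right)
  also have "\<dots> = (\<Sum>l<?n. real_of_int ((A ^\<^sub>m Suc m) $$ (i, l)) * z (vs ! l))"
  proof (intro sum.cong refl)
    fix l assume "l \<in> {..<?n}"
    then have "(A ^\<^sub>m Suc m) $$ (i, l) = (\<Sum>j<?n. (A ^\<^sub>m m) $$ (i, j) * A $$ (j, l))"
      using Am assms(1) Suc.prems by (simp add: scalar_prod_def atLeast0LessThan)
    then show "(\<Sum>j<?n. real_of_int ((A ^\<^sub>m m) $$ (i, j) * A $$ (j, l))) * z (vs ! l) =
        real_of_int ((A ^\<^sub>m Suc m) $$ (i, l)) * z (vs ! l)"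
      by simp
  qed
  finally show ?case .
qed

text \<open>By \<open>not_arcs\<close> no 1 of \<open>P\<close> lies at a corner of the T-block, so
  deleting the arcs of the block leaves exactly those from \<open>x\<close> to
  \<open>\<sigma> x\<close>.\<close>

lemma perm_digraph_P_subgraph:
  assumes "fin_digraph \<Gamma>" and blue: "no_multiple_blue_arcs \<Gamma> c"
    and corr: "corresponding_mat \<Gamma> c vs A" and \<sigma>: "\<sigma> permutes verts \<Gamma>"
    and ne: "u\<^sub>1 \<noteq> u\<^sub>2" "v\<^sub>1 \<noteq> v\<^sub>2" and not_arcs: "\<sigma> u\<^sub>1 \<notin> {v\<^sub>1, v\<^sub>2}" "\<sigma> u\<^sub>2 \<notin> {v\<^sub>1, v\<^sub>2}"
    and entry: "\<And>i j. i < length vs \<Longrightarrow> j < length vs \<Longrightarrow>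
      A $$ (i, j) = pt_entry \<sigma> u\<^sub>1 v\<^sub>1 u\<^sub>2 v\<^sub>2 (vs ! i) (vs ! j)"
  shows "perm_digraph (P_subgraph \<Gamma> c u\<^sub>1 v\<^sub>1 u\<^sub>2 v\<^sub>2) \<sigma>"
proof -
  interpret fin_digraph \<Gamma>
    by fact
  let ?H = "P_subgraph \<Gamma> c u\<^sub>1 v\<^sub>1 u\<^sub>2 v\<^sub>2" and ?E = "pt_entry \<sigma> u\<^sub>1 v\<^sub>1 u\<^sub>2 v\<^sub>2"
  note card = card_arcs_between_pt_entry[OF corr _ _ entry]
  have H: "verts ?H = verts \<Gamma>" "tail ?H = tail \<Gamma>" "head ?H = head \<Gamma>" "arcs ?H \<subseteq> arcs \<Gamma>"
    by (auto simp: P_subgraph_def)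
  have pos: "0 < ?E (tail \<Gamma> e) (head \<Gamma> e)" if "e \<in> arcs \<Gamma>" "c e = Blue" for e
  proof -
    have "e \<in> arcs_between \<Gamma> c Blue (tail \<Gamma> e) (head \<Gamma> e)"
      using that by (simp add: arcs_between_def arc_to_ends_def)
    moreover have "finite (arcs_between \<Gamma> c Blue (tail \<Gamma> e) (head \<Gamma> e))"
      by (simp add: arcs_between_def)
    ultimately show ?thesis
      using card(1)[of "tail \<Gamma> e" "head \<Gamma> e"] that(1)
      by (metis card_gt_0_iff empty_iff head_in_verts tail_in_verts zero_less_nat_eq)
  qed
  have neg: "?E (tail \<Gamma> e) (head \<Gamma> e) < 0" if "e \<in> arcs \<Gamma>" "c e = Red" for e
  proof -
    have "e \<in> arcs_between \<Gamma> c Red (tail \<Gamma> e) (head \<Gamma> e)"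
      using that by (simp add: arcs_between_def arc_to_ends_def)
    moreover have "finite (arcs_between \<Gamma> c Red (tail \<Gamma> e) (head \<Gamma> e))"
      by (simp add: arcs_between_def)
    ultimately show ?thesis
      using card(2)[of "tail \<Gamma> e" "head \<Gamma> e"] that(1)
      by (metis card_gt_0_iff empty_iff head_in_verts tail_in_verts zero_less_nat_eq neg_0_less_iff_less)
  qed
  have arcs_H: "e \<in> arcs ?H \<longleftrightarrow> e \<in> arcs \<Gamma> \<and> c e = Blue \<and> head \<Gamma> e = \<sigma> (tail \<Gamma> e)" for e
  proof (cases "e \<in> arcs \<Gamma>")
    case True
    have e: "e \<in> arcs ?H \<longleftrightarrow>
        \<not> (c e = Red \<and> (tail \<Gamma> e = u\<^sub>1 \<and> head \<Gamma> e = v\<^sub>1 \<or> tail \<Gamma> e = u\<^sub>2 \<and> head \<Gamma> e = v\<^sub>2) \<or>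
           c e = Blue \<and> (tail \<Gamma> e = u\<^sub>1 \<and> head \<Gamma> e = v\<^sub>2 \<or> tail \<Gamma> e = u\<^sub>2 \<and> head \<Gamma> e = v\<^sub>1))"
      using True by (auto simp: P_subgraph_def T_subgraph_def arcs_between_def arc_to_ends_def)
    show ?thesis
    proof (cases "c e")
      case Blue
      then show ?thesis
        using True pos[OF True] ne not_arcs unfolding e
        by (auto simp: pt_entry_def of_bool_def split: if_splits)
    next
      case Red
      then show ?thesis
        using True neg[OF True] ne unfolding e
        by (auto simp: pt_entry_def of_bool_def split: if_splits)
    qed
  qed (use H(4) in auto)
  have "inj_on (tail \<Gamma>) (arcs ?H)"
    using blue by (auto simp: inj_on_def arcs_H no_multiple_blue_arcs_def arc_to_ends_def)
  moreover have "x \<in> tail \<Gamma> ` arcs ?H" if x: "x \<in> verts \<Gamma>" for x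
  proof -
    have "\<sigma> x \<in> verts \<Gamma>"
      using x permutes_in_image[OF \<sigma>] by blast
    moreover have "?E x (\<sigma> x) = 1"
      using not_arcs by (auto simp: pt_entry_def of_bool_def)
    ultimately have "arcs_between \<Gamma> c Blue x (\<sigma> x) \<noteq> {}"
      using card(1)[OF x] by fastforce
    then show ?thesis
      by (auto simp: arcs_between_def arcs_H arc_to_ends_def)
  qed
  ultimately have "bij_betw (tail \<Gamma>) (arcs ?H) (verts \<Gamma>)"
    using H(4) by (auto simp: bij_betw_def)
  then show ?thesis
    using \<sigma> by unfold_locales (auto simp: H arcs_H)
qed

section \<open>Classification of the graphs of finite order\<close>

theorem theorem3p1:
  fixes \<Gamma> :: "('v, 'a) pre_digraph" and c :: "'a \<Rightarrow> colour"
    and u\<^sub>1 v\<^sub>1 u\<^sub>2 v\<^sub>2 :: 'v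
  assumes "PT_graph \<Gamma> c"
    and "Digraph_Component.connected \<Gamma>"
    and "exactly_two_red_arcs \<Gamma> c u\<^sub>1 v\<^sub>1 u\<^sub>2 v\<^sub>2"
    and "no_multiple_blue_arcs \<Gamma> c"
  shows "(\<exists>\<C>. consists_of_disjoint_cycles (P_subgraph \<Gamma> c u\<^sub>1 v\<^sub>1 u\<^sub>2 v\<^sub>2) \<C>) \<and>
    ((\<forall>vs A. corresponding_mat \<Gamma> c vs A \<longrightarrow> finite_mult_order A) \<longrightarrow>
      of_listed_type \<Gamma> c u\<^sub>1 v\<^sub>1 u\<^sub>2 v\<^sub>2 \<or>
      of_listed_type (reverse_digraph \<Gamma>) c v\<^sub>1 u\<^sub>1 v\<^sub>2 u\<^sub>2)"
proof -
  let ?H = "P_subgraph \<Gamma> c u\<^sub>1 v\<^sub>1 u\<^sub>2 v\<^sub>2"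
  interpret fin_digraph \<Gamma>
    using assms(1) by (simp add: PT_graph_def)
  obtain \<sigma> vs A where corr: "corresponding_mat \<Gamma> c vs A" and \<sigma>: "\<sigma> permutes verts \<Gamma>"
    and verts: "u\<^sub>1 \<in> verts \<Gamma>" "v\<^sub>1 \<in> verts \<Gamma>" "u\<^sub>2 \<in> verts \<Gamma>" "v\<^sub>2 \<in> verts \<Gamma>"
    and ne: "u\<^sub>1 \<noteq> u\<^sub>2" "v\<^sub>1 \<noteq> v\<^sub>2" and not_arcs: "\<sigma> u\<^sub>1 \<notin> {v\<^sub>1, v\<^sub>2}" "\<sigma> u\<^sub>2 \<notin> {v\<^sub>1, v\<^sub>2}"
    and entry: "\<And>i j. i < length vs \<Longrightarrow> j < length vs \<Longrightarrow>
      A $$ (i, j) = pt_entry \<sigma> u\<^sub>1 v\<^sub>1 u\<^sub>2 v\<^sub>2 (vs ! i) (vs ! j)"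
    using PT_graphE[OF assms(1,3,4)] by metis
  have H: "verts ?H = verts \<Gamma>" "tail ?H = tail \<Gamma>" "head ?H = head \<Gamma>"
    by (simp_all add: P_subgraph_def)
  interpret H: perm_digraph ?H \<sigma>
    using fin_digraph assms(4) corr \<sigma> ne not_arcs entry by (rule perm_digraph_P_subgraph)
  interpret R: perm_digraph "reverse_digraph ?H" "inv_into UNIV \<sigma>"
    by (rule H.perm_digraph_reverse)
  \<comment> \<open>A permutation and its inverse have the same orbits, so \<open>cover\<close> and
    the pattern carry over to the reverse.\<close>
  have orbit_inv: "R.Q = H.Q"
    using orbit_inv_eq[OF H.permutation] by blast
  have "H.Q x \<in> {H.Q u\<^sub>1, H.Q u\<^sub>2, H.Q v\<^sub>1, H.Q v\<^sub>2}" if x: "x \<in> verts \<Gamma>" for x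
  proof (rule ccontr)
    assume not: "\<not> ?thesis"
    \<comment> \<open>Arcs of \<open>?H\<close> stay within an orbit of \<open>\<sigma>\<close>; by
      \<open>not\<close>, both ends of every other arc lie outside the orbit of
      \<open>x\<close>.\<close>
    have "head \<Gamma> e \<in> H.Q x \<longleftrightarrow> tail \<Gamma> e \<in> H.Q x" if e: "e \<in> arcs \<Gamma>" for e
    proof (cases "e \<in> arcs ?H")
      case True
      then show ?thesis
        using H.head[of e] by (simp add: H H.in_orbit_iff permutation_orbit_step H.permutation)
    next
      case False
      then have "tail \<Gamma> e \<in> {u\<^sub>1, u\<^sub>2}" "head \<Gamma> e \<in> {v\<^sub>1, v\<^sub>2}"
        using e by (auto simp: P_subgraph_def T_subgraph_def arcs_between_def arc_to_ends_def)
      then show ?thesis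
        using not by (auto simp: H.in_orbit_iff)
    qed
    then have "u\<^sub>1 \<in> H.Q x"
      using connected_closed_set[OF assms(2), of "H.Q x" x u\<^sub>1] x verts(1)
      by (auto simp: H.in_orbit_iff)
    then show False
      using not by (simp add: H.in_orbit_iff)
  qed
  then have cover: "H.Q ` verts \<Gamma> = {H.Q u\<^sub>1, H.Q u\<^sub>2, H.Q v\<^sub>1, H.Q v\<^sub>2}"
    using verts by auto
  show ?thesis
  proof (intro conjI impI)
    show "\<exists>\<C>. consists_of_disjoint_cycles ?H \<C>"
      using H.consists_of_orbits by blast
  next
    assume "\<forall>vs A. corresponding_mat \<Gamma> c vs A \<longrightarrow> finite_mult_order A"
    then obtain K where K: "0 < K" "A ^\<^sub>m K = 1\<^sub>m (dim_row A)"
      using corr by (auto simp: finite_mult_order_def)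
    have vs: "distinct vs" "set vs = verts \<Gamma>" "A \<in> carrier_mat (length vs) (length vs)"
      using corr by (simp_all add: corresponding_mat_def)
    have "(pt_op \<sigma> u\<^sub>1 v\<^sub>1 u\<^sub>2 v\<^sub>2 ^^ K) z x = z x" for z x
    proof (cases "x \<in> verts \<Gamma>")
      case True
      then obtain i where i: "i < length vs" "x = vs ! i"
        using vs(2) by (metis in_set_conv_nth)
      have "(pt_op \<sigma> u\<^sub>1 v\<^sub>1 u\<^sub>2 v\<^sub>2 ^^ m) z x =
          (\<Sum>j<length vs. real_of_int ((A ^\<^sub>m m) $$ (i, j)) * z (vs ! j))" for m
        unfolding i(2) using vs \<sigma> verts entry i(1)
        by (intro funpow_pt_op_eq_pow_mat) auto
      from this[of K] this[of 0] show ?thesis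
        using K(2) by simp
    next
      \<comment> \<open>\<open>pt_op\<close> acts on functions on the whole type, and it leaves the
        values outside the vertex set unchanged.\<close>
      case False
      have "(pt_op \<sigma> u\<^sub>1 v\<^sub>1 u\<^sub>2 v\<^sub>2 ^^ m) z x = z x" for m
      proof (induction m)
        case (Suc m)
        have "\<sigma> x = x" "x \<noteq> u\<^sub>1" "x \<noteq> u\<^sub>2"
          using False \<sigma> verts by (auto simp: permutes_def)
        with Suc show ?case
          by (simp add: pt_op_def)
      qed simp
      then show ?thesis .
    qed
    then have "(pt_op \<sigma> u\<^sub>1 v\<^sub>1 u\<^sub>2 v\<^sub>2 ^^ K) z = z" for z
      by (rule ext)
    with H.permutation K(1) interpret pt_finite_order \<sigma> u\<^sub>1 v\<^sub>1 u\<^sub>2 v\<^sub>2 K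
      using not_arcs by (intro pt_finite_order.intro) simp_all
    have "listed_pattern (H.Q u\<^sub>1) (H.Q u\<^sub>2) (H.Q v\<^sub>1) (H.Q v\<^sub>2) \<or>
        listed_pattern (H.Q v\<^sub>1) (H.Q v\<^sub>2) (H.Q u\<^sub>1) (H.Q u\<^sub>2)"
      using no_eigenvalue_greater_1 no_eigenvalue_less_1 not_all_distinct_orbits
      by (rule listed_patternI)
    then show "of_listed_type \<Gamma> c u\<^sub>1 v\<^sub>1 u\<^sub>2 v\<^sub>2 \<or> of_listed_type (reverse_digraph \<Gamma>) c v\<^sub>1 u\<^sub>1 v\<^sub>2 u\<^sub>2"
    proof
      assume "listed_pattern (H.Q u\<^sub>1) (H.Q u\<^sub>2) (H.Q v\<^sub>1) (H.Q v\<^sub>2)"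
      then have "of_listed_type \<Gamma> c u\<^sub>1 v\<^sub>1 u\<^sub>2 v\<^sub>2"
        using cover ne by (intro H.of_listed_type_orbits) (simp_all add: H)
      then show ?thesis ..
    next
      assume "listed_pattern (H.Q v\<^sub>1) (H.Q v\<^sub>2) (H.Q u\<^sub>1) (H.Q u\<^sub>2)"
      moreover have "verts (reverse_digraph ?H) = verts \<Gamma>"
        by (simp add: reverse_digraph_def H)
      ultimately have "of_listed_type (reverse_digraph \<Gamma>) c v\<^sub>1 u\<^sub>1 v\<^sub>2 u\<^sub>2"
        using cover ne
        by (intro R.of_listed_type_orbits) (simp_all add: P_subgraph_reverse orbit_inv insert_commute)
      then show ?thesis ..
    qed
  qed
qed

end
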